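(* Let $n\ge1$ be an integer and consider the $2^{n+1}$ orientations of the path with $n+1$ edges. (a) If $n$ is odd, then exactly a fraction $\frac12$ of these oriented paths are locally tournament Sidorenko (LTS) and exactly a fraction $\frac12$ are locally tournament anti-Sidorenko (LTAS). (b) If $n$ is even, then the fraction of these oriented paths which are neither LTS nor LTAS is at most $\binom{n}{n/2}2^{-n}$, the fraction that are LTS is at least $\frac12\left(1-\binom{n}{n/2}2^{-n}\right)$, and the fraction that are LTAS is at least $\frac12\left(1-\binom{n}{n/2}2^{-n}\right)$.
   Context: A weighted tournament on $N$ vertices is a function $A:[N]^2\to[0,1]$ with $A(x,y)+A(y,x)=1$ for all $x,y$ (so $A(x,x)=1/2$). For a digraph $D$, $t_D(A)=N^{-v(D)}\sum_{\phi:V(D)\to[N]}\prod_{(x,y)\in E(D)}A(\phi(x),\phi(y))$. Write $A=\frac12J+B$ with $J$ the all-ones $N\times N$ matrix and $B$ skew-symmetric, and let $\lambda_{\max}(B)$ be the largest modulus of an eigenvalue of $B$. A digraph $D$ is LTS if there is $\varepsilon=\varepsilon(D)>0$ such that for every $N$ and every weighted tournament $A=\frac12J+B$ on $N$ vertices with $\lambda_{\max}(B)\le\varepsilon N$ one has $t_D(A)\ge2^{-e(D)}$; it is LTAS if there is such an $\varepsilon$ with $t_D(A)\le2^{-e(D)}$ for all such $A$. Each edge of the path on vertices $0,1,\dots,n+1$ may be oriented left-to-right or right-to-left; fractions are with respect to all $2^{n+1}$ choices. *)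

theory Defs
  imports
    "Jordan_Normal_Form.Spectral_Radius"
    "Graph_Theory.Pair_Digraph"
    "HOL-Library.FuncSet"
begin

(* The vertex set [N] is {0..<N}. *)
definition weighted_tournament :: "nat \<Rightarrow> real mat \<Rightarrow> bool" where
  "weighted_tournament N A \<longleftrightarrow>
     A \<in> carrier_mat N N \<and>
     (\<forall>x<N. \<forall>y<N. 0 \<le> A $$ (x, y) \<and> A $$ (x, y) \<le> 1 \<and> A $$ (x, y) + A $$ (y, x) = 1)"

definition all_ones_mat :: "nat \<Rightarrow> real mat" where
  "all_ones_mat N = mat N N (\<lambda>_. 1)"

(* The matrix B in A = J/2 + B. *)
definition skew_part :: "nat \<Rightarrow> real mat \<Rightarrow> real mat" where
  "skew_part N A = A - (1 / 2) \<cdot>\<^sub>m all_ones_mat N"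

(* The largest modulus of a complex eigenvalue. Like spectral_radius, it is only
   meaningful for square matrices of positive dimension. *)
definition lambda_max :: "real mat \<Rightarrow> real" where
  "lambda_max B = spectral_radius (map_mat complex_of_real B)"

definition hom_density :: "'a pair_pre_digraph \<Rightarrow> nat \<Rightarrow> real mat \<Rightarrow> real" where
  "hom_density D N A =
     (\<Sum>\<phi> \<in> pverts D \<rightarrow>\<^sub>E {0..<N}. \<Prod>(x, y) \<in> parcs D. A $$ (\<phi> x, \<phi> y))
       / real N ^ card (pverts D)"

(* Locally tournament Sidorenko and locally tournament anti-Sidorenko;
   both are intended for finite digraphs D. *)
definition LTS :: "'a pair_pre_digraph \<Rightarrow> bool" where
  "LTS D \<longleftrightarrow>
     (\<exists>\<epsilon>>0. \<forall>N>0. \<forall>A. weighted_tournament N A \<and> lambda_max (skew_part N A) \<le> \<epsilon> * real N \<longrightarrow>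
        hom_density D N A \<ge> (1 / 2) ^ card (parcs D))"

definition LTAS :: "'a pair_pre_digraph \<Rightarrow> bool" where
  "LTAS D \<longleftrightarrow>
     (\<exists>\<epsilon>>0. \<forall>N>0. \<forall>A. weighted_tournament N A \<and> lambda_max (skew_part N A) \<le> \<epsilon> * real N \<longrightarrow>
        hom_density D N A \<le> (1 / 2) ^ card (parcs D))"

(* The path on 0, 1, ..., length os: its i-th edge joins i and i + 1, and is
   oriented left-to-right iff os ! i. *)
definition oriented_path :: "bool list \<Rightarrow> nat pair_pre_digraph" where
  "oriented_path os =
     \<lparr> pverts = {0..length os},
       parcs = (\<lambda>i. if os ! i then (i, i + 1) else (i + 1, i)) ` {0..<length os} \<rparr>"

(* Orientations are counted as labelled objects, i.e. by their edge choices and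
   not up to isomorphism. *)
definition path_fraction :: "nat \<Rightarrow> (nat pair_pre_digraph \<Rightarrow> bool) \<Rightarrow> real" where
  "path_fraction m P =
     real (card {os :: bool list. length os = m \<and> P (oriented_path os)}) / 2 ^ m"

lemma pair_digraph_oriented_path: "pair_digraph (oriented_path os)"
  by unfold_locales (auto simp: oriented_path_def split: if_splits)

lemma card_parcs_oriented_path: "card (parcs (oriented_path os)) = length os"
proof -
  have "inj_on (\<lambda>i. if os ! i then (i, i + 1) else (i + 1, i)) {0..<length os}"
    by (auto simp: inj_on_def split: if_splits)
  from card_image[OF this] show ?thesis
    unfolding oriented_path_def pair_pre_digraph.simps card_atLeastLessThan by simp
qed

end

theory Submission
  imports Defs
begin

text \<open>
  Write \<open>K = B / N\<close>, \<open>e\<^sub>k = K\<^sup>k 1\<close> and \<open>b\<^sub>k = \<langle>1, e\<^sub>k\<rangle> / N\<close>. Expanding every factor of the density of a path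
  with edge signs \<open>s\<^sub>i\<close> as \<open>J / 2 \<plusminus> B\<close> gives a polynomial in the \<open>b\<^sub>k\<close>. Skew symmetry makes
  the odd \<open>b\<^sub>k\<close> vanish and gives \<open>b\<^sub>2\<^sub>k = (-1)\<^sup>k |e\<^sub>k|\<^sup>2 / N\<close>. If the eigenvalues of \<open>K\<close> are smaller than \<open>r\<close>
  in modulus, then \<open>|e\<^sub>k|\<^sup>2 / r\<^sup>2\<^sup>k\<close> is bounded in \<open>k\<close>; by skew symmetry it is also convex in \<open>k\<close>,
  hence nonincreasing. So \<open>|b\<^sub>k| \<le> r\<^sup>2 |b\<^sub>2|\<close> for \<open>k \<ge> 3\<close>, uniformly in \<open>N\<close>, and the density times \<open>2\<close> to
  the number of edges is \<open>1 + 4 b\<^sub>2 (\<Sum> s\<^sub>i s\<^sub>i\<^sub>+\<^sub>1) + O(r\<^sup>2 |b\<^sub>2|)\<close>. As \<open>b\<^sub>2 \<le> 0\<close>, with strict inequality for suitable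
  tournaments on two vertices, a path is LTS or LTAS according to the sign of \<open>\<Sum> s\<^sub>i s\<^sub>i\<^sub>+\<^sub>1\<close>,
  and the products \<open>s\<^sub>i s\<^sub>i\<^sub>+\<^sub>1\<close> range uniformly over all sign patterns.
\<close>

section \<open>Counting orientations by agreements\<close>

text \<open>On an orientation list this counts the inner vertices at which the path keeps its
  direction.\<close>

fun agreements :: "'a list \<Rightarrow> nat" where
  "agreements (x # y # zs) = (if x = y then 1 else 0) + agreements (y # zs)"
| "agreements _ = 0"

lemma agreements_le: "agreements xs \<le> length xs - 1"
  by (induction xs rule: agreements.induct) auto

lemma finite_bool_lists: "finite {os :: bool list. length os = m \<and> P os}"
  using finite_lists_length_eq[of "UNIV :: bool set" m] by (rule rev_finite_subset) auto

text \<open>Once \<open>x\<close> is fixed, a list is determined by which of the \<open>n\<close>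
  consecutive pairs agree, so the lists correspond to subsets of size \<open>k\<close>. Splitting by
  the first pair is Pascal's rule.\<close>

lemma card_agreements_Cons:
  "card {os :: bool list. length os = n \<and> agreements (x # os) = k} = n choose k"
proof (induction n arbitrary: x k)
  case 0
  have "{os :: bool list. length os = 0 \<and> agreements (x # os) = k} = (if k = 0 then {[]} else {})"
    by auto
  then show ?case by simp
next
  case (Suc n)
  let ?S = "\<lambda>x k. {os :: bool list. length os = n \<and> agreements (x # os) = k}"
  have fin: "finite (?S y j)" for y j
    using finite_bool_lists[of n "\<lambda>os. agreements (y # os) = j"] by simp
  show ?case
  proof (cases k)
    case 0
    have "{os. length os = Suc n \<and> agreements (x # os) = k} = (#) (\<not> x) ` ?S (\<not> x) 0"
      using 0 by (auto simp: length_Suc_conv image_iff split: if_splits)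
    then show ?thesis using Suc.IH[of "\<not> x" 0] 0 by (simp add: card_image)
  next
    case (Suc j)
    have "{os. length os = Suc n \<and> agreements (x # os) = k}
        = (#) x ` ?S x j \<union> (#) (\<not> x) ` ?S (\<not> x) k"
      using Suc by (auto simp: length_Suc_conv image_iff split: if_splits)
    moreover have "card ((#) x ` ?S x j \<union> (#) (\<not> x) ` ?S (\<not> x) k)
        = card ((#) x ` ?S x j) + card ((#) (\<not> x) ` ?S (\<not> x) k)"
      by (intro card_Un_disjoint finite_imageI fin) auto
    ultimately show ?thesis
      using Suc.IH[of x j] Suc.IH[of "\<not> x" k] Suc by (simp add: card_image)
  qed
qed

lemma card_agreements_eq:
  "card {os :: bool list. length os = Suc n \<and> agreements os = k} = 2 * (n choose k)"
proof -
  let ?S = "\<lambda>x. {os :: bool list. length os = n \<and> agreements (x # os) = k}"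
  have fin: "finite (?S y)" for y
    using finite_bool_lists[of n "\<lambda>os. agreements (y # os) = k"] by simp
  have "{os :: bool list. length os = Suc n \<and> agreements os = k}
      = (#) True ` ?S True \<union> (#) False ` ?S False"
    by (auto simp: length_Suc_conv image_iff)
  moreover have "card ((#) True ` ?S True \<union> (#) False ` ?S False)
      = card ((#) True ` ?S True) + card ((#) False ` ?S False)"
    by (intro card_Un_disjoint finite_imageI fin) auto
  ultimately show ?thesis
    by (simp add: card_image card_agreements_Cons)
qed

lemma card_agreements:
  "card {os :: bool list. length os = Suc n \<and> P (agreements os)}
     = 2 * (\<Sum>k | k \<le> n \<and> P k. n choose k)"
proof -
  have "{os :: bool list. length os = Suc n \<and> P (agreements os)}
      = (\<Union>k\<in>{k. k \<le> n \<and> P k}. {os. length os = Suc n \<and> agreements os = k})"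
  proof (intro equalityI subsetI)
    fix os :: "bool list"
    assume "os \<in> {os. length os = Suc n \<and> P (agreements os)}"
    then show "os \<in> (\<Union>k\<in>{k. k \<le> n \<and> P k}. {os. length os = Suc n \<and> agreements os = k})"
      using agreements_le[of os] by auto
  qed auto
  also have "card \<dots> = (\<Sum>k | k \<le> n \<and> P k. card {os :: bool list. length os = Suc n \<and> agreements os = k})"
    by (rule card_UN_disjoint) (auto simp: finite_bool_lists)
  finally show ?thesis by (simp add: card_agreements_eq sum_distrib_left)
qed

lemma sum_choose_lower_upper:
  "(\<Sum>k | k \<le> n \<and> 2 * k < n. n choose k) = (\<Sum>k | k \<le> n \<and> n < 2 * k. n choose k)"
proof (rule sum.reindex_bij_witness[where i = "\<lambda>k. n - k" and j = "\<lambda>k. n - k"])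
  fix k assume "k \<in> {k. k \<le> n \<and> 2 * k < n}"
  then show "n choose (n - k) = n choose k" by (simp add: binomial_symmetric[of k n])
qed auto

lemma sum_choose_halves:
  "2 * (\<Sum>k | k \<le> n \<and> n < 2 * k. n choose k) + (if even n then n choose (n div 2) else 0) = 2 ^ n"
proof -
  have "(\<Sum>k\<le>n. n choose k) = (\<Sum>k | k \<le> n \<and> 2 * k < n. n choose k)
      + (\<Sum>k | k \<le> n \<and> n < 2 * k. n choose k) + (\<Sum>k | k \<le> n \<and> 2 * k = n. n choose k)"
  proof -
    have "{..n} = ({k. k \<le> n \<and> 2 * k < n} \<union> {k. k \<le> n \<and> n < 2 * k}) \<union> {k. k \<le> n \<and> 2 * k = n}"
      by auto
    then show ?thesis
      by (simp only:) (subst sum.union_disjoint, auto)+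
  qed
  moreover have "{k. k \<le> n \<and> 2 * k = n} = (if even n then {n div 2} else {})" by auto
  ultimately show ?thesis
    using choose_row_sum[of n] sum_choose_lower_upper[of n] by auto
qed

section \<open>Expansion of the density of an oriented path\<close>

text \<open>The sign of \<open>B\<close> in the factor of an edge: reversing the edge turns 1/2 + B
  into 1/2 - B.\<close>

definition edge_sign :: "bool \<Rightarrow> real" where
  "edge_sign s = (if s then 1 else - 1)"

fun turn_sum :: "bool list \<Rightarrow> real" where
  "turn_sum (x # y # zs) = edge_sign x * edge_sign y + turn_sum (y # zs)"
| "turn_sum _ = 0"

lemma turn_sum_agreements:
  "turn_sum os = 2 * real (agreements os) - real (length os - 1)"
  by (induction os rule: turn_sum.induct) (auto simp: edge_sign_def)

text \<open>Applying the edges one by one to the constant 1 produces combinations of the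
  \<open>e_k\<close>; these are the coefficients, with a factor N/2 removed per edge.
  \<open>J\<close> collapses everything into index 0 through the moments \<open>b j\<close>, and
  \<open>B\<close> shifts the index.\<close>

fun path_coeff :: "(nat \<Rightarrow> real) \<Rightarrow> bool list \<Rightarrow> nat \<Rightarrow> real" where
  "path_coeff b [] k = (if k = 0 then 1 else 0)"
| "path_coeff b (s # os) 0 = (\<Sum>j\<le>length os. b j * path_coeff b os j)"
| "path_coeff b (s # os) (Suc k) = 2 * edge_sign s * path_coeff b os k"

text \<open>The constant depends on \<open>os\<close> alone and not on \<open>b\<close>, which later
  makes the error terms uniform in the number of vertices.\<close>

lemma path_coeff_bounded:
  "\<exists>C. \<forall>b k. (\<forall>j. \<bar>b j\<bar> \<le> 1) \<longrightarrow> \<bar>path_coeff b os k\<bar> \<le> C"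
proof (induction os)
  case Nil
  show ?case by (rule exI[of _ 1]) simp
next
  case (Cons s os)
  then obtain C where C: "\<And>b k. (\<forall>j. \<bar>b j\<bar> \<le> 1) \<Longrightarrow> \<bar>path_coeff b os k\<bar> \<le> C" by blast
  \<comment> \<open>The constant adds the bounds of the two cases: index 0 is a sum of
    \<open>length os + 1\<close> terms, and a shifted index doubles the coefficient.\<close>
  have "\<bar>path_coeff b (s # os) k\<bar> \<le> 2 * C + real (Suc (length os)) * C"
    if b: "\<forall>j. \<bar>b j\<bar> \<le> 1" for b k
  proof -
    have C0: "C \<ge> 0" using C[OF b, of 0] by linarith
    show ?thesis
    proof (cases k)
      case 0
      have "\<bar>b j * path_coeff b os j\<bar> \<le> C" for j
        using mult_mono[of "\<bar>b j\<bar>" 1 "\<bar>path_coeff b os j\<bar>" C] b C[OF b] by (simp add: abs_mult)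
      then have "\<bar>\<Sum>j\<le>length os. b j * path_coeff b os j\<bar> \<le> (\<Sum>j\<le>length os. C)"
        by (intro sum_abs[THEN order_trans] sum_mono)
      then show ?thesis using 0 C0 by simp
    next
      case (Suc i)
      then have "\<bar>path_coeff b (s # os) k\<bar> = 2 * \<bar>path_coeff b os i\<bar>"
        by (simp add: edge_sign_def abs_mult)
      then show ?thesis using C[OF b, of i] C0 by (simp add: add_increasing2)
    qed
  qed
  then show ?case by blast
qed

text \<open>Isolates, without mention of N, what the expansion uses from a small spectral radius:
  \<open>b 2\<close> leads, and every later moment is smaller than it by a factor \<delta>.\<close>

definition small_moments :: "real \<Rightarrow> (nat \<Rightarrow> real) \<Rightarrow> bool" where
  "small_moments \<delta> b \<longleftrightarrow> b 0 = 1 \<and> b 1 = 0 \<and> \<bar>b 2\<bar> \<le> \<delta> \<and> \<delta> \<le> 1 \<and> (\<forall>k\<ge>3. \<bar>b k\<bar> \<le> \<delta> * \<bar>b 2\<bar>)"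

lemma small_moments_tail:
  assumes "small_moments \<delta> b" "j \<ge> 1"
  shows "\<bar>b j\<bar> \<le> \<delta>"
proof -
  have d: "0 \<le> \<delta>" "\<delta> \<le> 1" "\<bar>b 2\<bar> \<le> \<delta>" using assms(1) by (auto simp: small_moments_def)
  have "\<delta> * \<bar>b 2\<bar> \<le> \<delta>" using d mult_left_mono[of "\<bar>b 2\<bar>" 1 \<delta>] by simp
  moreover have "j = 1 \<or> j = 2 \<or> j \<ge> 3" using assms(2) by linarith
  ultimately show ?thesis
    using assms(1) d by (elim disjE) (auto simp: small_moments_def intro: order_trans)
qed

lemma small_moments_le_1:
  assumes "small_moments \<delta> b"
  shows "\<forall>j. \<bar>b j\<bar> \<le> 1"
proof
  fix j show "\<bar>b j\<bar> \<le> 1"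
    using small_moments_tail[OF assms, of j] assms by (cases "j = 0") (auto simp: small_moments_def)
qed

text \<open>Taking \<open>J\<close> at every edge contributes 1; any other contribution to index 0
  carries some \<open>b j\<close> with j >= 1 and is therefore O(\<delta>).\<close>

lemma path_coeff_0_approx:
  "\<exists>C. \<forall>b \<delta>. small_moments \<delta> b \<longrightarrow> \<bar>path_coeff b os 0 - 1\<bar> \<le> C * \<delta>"
proof (induction os)
  case Nil
  show ?case by (rule exI[of _ 0]) simp
next
  case (Cons s os)
  then obtain C where C: "\<And>b \<delta>. small_moments \<delta> b \<Longrightarrow> \<bar>path_coeff b os 0 - 1\<bar> \<le> C * \<delta>" by blast
  obtain D where D: "\<And>b k. (\<forall>j. \<bar>b j\<bar> \<le> 1) \<Longrightarrow> \<bar>path_coeff b os k\<bar> \<le> D"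
    using path_coeff_bounded by blast
  have "\<bar>path_coeff b (s # os) 0 - 1\<bar> \<le> (C + real (length os) * D) * \<delta>" if b: "small_moments \<delta> b" for b \<delta>
  proof -
    have d: "\<delta> \<ge> 0" using b by (auto simp: small_moments_def)
    have "(\<Sum>j\<le>length os. b j * path_coeff b os j)
        = path_coeff b os 0 + (\<Sum>j=1..length os. b j * path_coeff b os j)"
      using b by (simp add: atMost_atLeast0 sum.atLeast_Suc_atMost small_moments_def)
    moreover have "\<bar>\<Sum>j=1..length os. b j * path_coeff b os j\<bar> \<le> (\<Sum>j=1..length os. \<delta> * D)"
      using small_moments_tail[OF b] D[OF small_moments_le_1[OF b]] d
      by (intro sum_abs[THEN order_trans] sum_mono) (auto simp: abs_mult intro!: mult_mono)
    ultimately show ?thesis using C[OF b] by (simp add: algebra_simps)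
  qed
  then show ?case by blast
qed

text \<open>In the sum defining the coefficient at 0, index 0 is the same quantity for a path with
  one edge less (induction), index 1 vanishes, index 2 gives \<open>4 * b 2\<close> times the sign
  product of the first two edges of \<open>os\<close> up to a relative O(\<delta>), and the rest is
  O(\<delta> |b 2|).\<close>

lemma path_density_approx:
  "\<exists>C. \<forall>b \<delta>. small_moments \<delta> b \<longrightarrow>
     \<bar>path_coeff b (s # os) 0 - 1 - 4 * b 2 * turn_sum os\<bar> \<le> C * (\<delta> * \<bar>b 2\<bar>)"
proof (induction os arbitrary: s rule: turn_sum.induct)
  case (1 x y zs)
  from "1.IH"[of x] obtain C where C: "\<And>b \<delta>. small_moments \<delta> b \<Longrightarrow>
     \<bar>path_coeff b (x # y # zs) 0 - 1 - 4 * b 2 * turn_sum (y # zs)\<bar> \<le> C * (\<delta> * \<bar>b 2\<bar>)" by blast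
  obtain D where D: "\<And>b k. (\<forall>j. \<bar>b j\<bar> \<le> 1) \<Longrightarrow> \<bar>path_coeff b (x # y # zs) k\<bar> \<le> D"
    using path_coeff_bounded by blast
  obtain E where E: "\<And>b \<delta>. small_moments \<delta> b \<Longrightarrow> \<bar>path_coeff b zs 0 - 1\<bar> \<le> E * \<delta>"
    using path_coeff_0_approx by blast
  let ?n = "length zs + 2"
  have "\<bar>path_coeff b (s # x # y # zs) 0 - 1 - 4 * b 2 * turn_sum (x # y # zs)\<bar>
      \<le> (C + real (length zs) * D + 4 * E) * (\<delta> * \<bar>b 2\<bar>)" if b: "small_moments \<delta> b" for b \<delta>
  proof -
    have d: "\<delta> \<ge> 0" using b by (auto simp: small_moments_def)
    let ?p = "path_coeff b (x # y # zs)"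
    let ?R = "\<Sum>j=3..?n. b j * ?p j"
    have "{..?n} = {0, 1, 2} \<union> {3..?n}" by auto
    then have "(\<Sum>j\<le>?n. b j * ?p j) = b 0 * ?p 0 + b 1 * ?p 1 + b 2 * ?p 2 + ?R"
      by (simp only:) (subst sum.union_disjoint, auto)
    moreover have "path_coeff b (s # x # y # zs) 0 = (\<Sum>j\<le>?n. b j * ?p j)"
      by simp
    \<comment> \<open>Index 2 forces \<open>B\<close> at both \<open>x\<close> and \<open>y\<close>,
      on top of index 0 for \<open>zs\<close>.\<close>
    moreover have "?p 2 = 4 * edge_sign x * edge_sign y * path_coeff b zs 0"
      by (simp add: numeral_2_eq_2)
    ultimately have split: "path_coeff b (s # x # y # zs) 0
        = ?p 0 + b 2 * (4 * edge_sign x * edge_sign y * path_coeff b zs 0) + ?R"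
      using b unfolding small_moments_def by simp
    have "\<bar>?R\<bar> \<le> (\<Sum>j=3..?n. (\<delta> * \<bar>b 2\<bar>) * D)"
      using b D[OF small_moments_le_1[OF b]] d
      by (intro sum_abs[THEN order_trans] sum_mono)
         (auto simp: abs_mult small_moments_def simp del: path_coeff.simps intro!: mult_mono)
    then have R: "\<bar>?R\<bar> \<le> real (length zs) * D * (\<delta> * \<bar>b 2\<bar>)" by (simp add: mult_ac)
    \<comment> \<open>The error of replacing the coefficient of \<open>zs\<close> by 1; it carries
      \<open>b 2\<close> besides the factor \<delta>.\<close>
    let ?T = "4 * (edge_sign x * edge_sign y * b 2) * (path_coeff b zs 0 - 1)"
    have "\<bar>?T\<bar> = 4 * \<bar>b 2\<bar> * \<bar>path_coeff b zs 0 - 1\<bar>"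
      by (simp add: abs_mult edge_sign_def)
    also have "\<dots> \<le> 4 * \<bar>b 2\<bar> * (E * \<delta>)" by (intro mult_left_mono E b) auto
    finally have T: "\<bar>?T\<bar> \<le> 4 * E * (\<delta> * \<bar>b 2\<bar>)" by (simp add: mult_ac)
    have "path_coeff b (s # x # y # zs) 0 - 1 - 4 * b 2 * turn_sum (x # y # zs)
        = (?p 0 - 1 - 4 * b 2 * turn_sum (y # zs)) + ?T + ?R"
      unfolding split by (simp add: algebra_simps del: path_coeff.simps)
    then have "\<bar>path_coeff b (s # x # y # zs) 0 - 1 - 4 * b 2 * turn_sum (x # y # zs)\<bar>
        \<le> C * (\<delta> * \<bar>b 2\<bar>) + 4 * E * (\<delta> * \<bar>b 2\<bar>) + real (length zs) * D * (\<delta> * \<bar>b 2\<bar>)"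
      using C[OF b] T R by linarith
    then show ?thesis by (simp only: distrib_right)
  qed
  then show ?case by blast
next
  case "2_1"
  show ?case by (rule exI[of _ 0]) (auto simp: small_moments_def)
next
  case ("2_2" v)
  show ?case by (rule exI[of _ 0]) (auto simp: small_moments_def)
qed

section \<open>Walk sums\<close>

lemma sum_PiE_insert:
  assumes "x \<notin> I"
  shows "(\<Sum>f\<in>PiE (insert x I) T. F f) = (\<Sum>f\<in>PiE I T. \<Sum>y\<in>T x. F (f(x := y)))"
proof -
  have "(\<Sum>f\<in>PiE (insert x I) T. F f) = (\<Sum>(y, f)\<in>T x \<times> PiE I T. F (f(x := y)))"
    unfolding PiE_insert_eq
    by (subst sum.reindex[OF inj_combinator[OF assms]]) (simp add: case_prod_unfold)
  also have "\<dots> = (\<Sum>y\<in>T x. \<Sum>f\<in>PiE I T. F (f(x := y)))"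
    by (rule sum.cartesian_product[symmetric])
  finally show ?thesis by (simp only: sum.swap[of _ "T x"])
qed

text \<open>Transfer operators: summing out the last vertex is absorbed into the end function
  \<open>g\<close>, which therefore has to be arbitrary in the induction.\<close>

lemma sum_PiE_walk:
  fixes K :: "'b \<Rightarrow> 'a \<Rightarrow> 'a \<Rightarrow> 'c::comm_semiring_1"
  shows "(\<Sum>\<phi>\<in>{0..length os} \<rightarrow>\<^sub>E S. (\<Prod>i<length os. K (os ! i) (\<phi> i) (\<phi> (Suc i))) * g (\<phi> (length os)))
     = (\<Sum>x\<in>S. foldr (\<lambda>s g x. \<Sum>y\<in>S. K s x y * g y) os g x)"
proof (induction os arbitrary: g rule: rev_induct)
  case Nil
  show ?case using sum_PiE_insert[of "0::nat" "{}" "\<lambda>f. g (f 0)" "\<lambda>_. S"] by simp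
next
  case (snoc s os)
  let ?m = "length os"
  let ?W = "\<lambda>\<phi>. \<Prod>i<?m. K (os ! i) (\<phi> i) (\<phi> (Suc i))"
  let ?F = "\<lambda>\<phi>. (\<Prod>i<length (os @ [s]). K ((os @ [s]) ! i) (\<phi> i) (\<phi> (Suc i))) * g (\<phi> (length (os @ [s])))"
  have F: "?F (\<phi>(Suc ?m := y)) = ?W \<phi> * (K s (\<phi> ?m) y * g y)" for \<phi> y
  proof -
    have "(\<Prod>i<?m. K ((os @ [s]) ! i) ((\<phi>(Suc ?m := y)) i) ((\<phi>(Suc ?m := y)) (Suc i))) = ?W \<phi>"
      by (rule prod.cong) (auto simp: nth_append)
    then show ?thesis by (simp add: mult_ac)
  qed
  have dom: "{0..length (os @ [s])} = insert (Suc ?m) {0..?m}" by auto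
  have "(\<Sum>\<phi>\<in>{0..length (os @ [s])} \<rightarrow>\<^sub>E S. ?F \<phi>)
      = (\<Sum>\<phi>\<in>{0..?m} \<rightarrow>\<^sub>E S. \<Sum>y\<in>S. ?F (\<phi>(Suc ?m := y)))"
    unfolding dom by (rule sum_PiE_insert[where F = ?F]) simp
  also have "\<dots> = (\<Sum>\<phi>\<in>{0..?m} \<rightarrow>\<^sub>E S. ?W \<phi> * (\<Sum>y\<in>S. K s (\<phi> ?m) y * g y))"
    unfolding F by (simp only: sum_distrib_left)
  also have "\<dots> = (\<Sum>x\<in>S. foldr (\<lambda>s g x. \<Sum>y\<in>S. K s x y * g y) os (\<lambda>x. \<Sum>y\<in>S. K s x y * g y) x)"
    by (rule snoc.IH)
  finally show ?case by simp
qed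

text \<open>Entry \<open>x\<close> of the vector \<open>e_k\<close>.\<close>

fun walks :: "nat \<Rightarrow> (nat \<Rightarrow> nat \<Rightarrow> real) \<Rightarrow> nat \<Rightarrow> nat \<Rightarrow> real" where
  "walks N K 0 x = 1"
| "walks N K (Suc k) x = (\<Sum>y<N. K x y * walks N K k y)"

definition moment :: "nat \<Rightarrow> (nat \<Rightarrow> nat \<Rightarrow> real) \<Rightarrow> nat \<Rightarrow> real" where
  "moment N K k = (\<Sum>x<N. walks N K k x) / real N"

definition skew_kernel :: "nat \<Rightarrow> real mat \<Rightarrow> nat \<Rightarrow> nat \<Rightarrow> real" where
  "skew_kernel N A x y = (A $$ (x, y) - 1 / 2) / real N"

text \<open>The span of the \<open>e_k\<close> is invariant under each edge operator: the constant
  part sends \<open>e_k\<close> to a multiple of \<open>b_k\<close> times the constant 1, and the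
  kernel part sends it to a multiple of \<open>e_(k+1)\<close>. The recursion of
  \<open>path_coeff\<close> records this.\<close>

lemma foldr_walks:
  assumes N: "N > 0"
    and L: "\<And>s x y. x < N \<Longrightarrow> y < N \<Longrightarrow> L s x y = 1 / 2 + edge_sign s * (real N * K x y)"
    and "x < N"
  shows "foldr (\<lambda>s g x. \<Sum>y<N. L s x y * g y) os (\<lambda>_. 1) x
     = (real N / 2) ^ length os * (\<Sum>k\<le>length os. path_coeff (moment N K) os k * walks N K k x)"
  using \<open>x < N\<close>
proof (induction os arbitrary: x)
  case Nil
  show ?case by simp
next
  case (Cons s os)
  let ?m = "length os" and ?c = "path_coeff (moment N K) os" and ?s = "edge_sign s"
  let ?q = "(real N / 2) ^ ?m"
  have "foldr (\<lambda>s g x. \<Sum>y<N. L s x y * g y) (s # os) (\<lambda>_. 1) x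
      = (\<Sum>y<N. (1 / 2 + ?s * (real N * K x y)) * (?q * (\<Sum>k\<le>?m. ?c k * walks N K k y)))"
    using Cons by (simp add: L)
  also have "\<dots> = (\<Sum>y<N. \<Sum>k\<le>?m. ?q * (?c k * (walks N K k y / 2 + ?s * real N * (K x y * walks N K k y))))"
    by (simp add: sum_distrib_left algebra_simps)
  also have "\<dots> = (\<Sum>k\<le>?m. \<Sum>y<N. ?q * (?c k * (walks N K k y / 2 + ?s * real N * (K x y * walks N K k y))))"
    by (rule sum.swap)
  also have "\<dots> = (\<Sum>k\<le>?m. ?q * (?c k * (real N / 2 * moment N K k + ?s * real N * walks N K (Suc k) x)))"
    using N by (simp add: moment_def sum_distrib_left sum.distrib sum_divide_distrib algebra_simps)
  also have "\<dots> = (\<Sum>k\<le>?m. (real N / 2 * ?q) * (moment N K k * ?c k + 2 * ?s * ?c k * walks N K (Suc k) x))"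
    by (rule sum.cong) (auto simp: algebra_simps)
  also have "\<dots> = (real N / 2 * ?q) * ((\<Sum>k\<le>?m. moment N K k * ?c k) + (\<Sum>k\<le>?m. 2 * ?s * ?c k * walks N K (Suc k) x))"
    by (simp only: sum_distrib_left sum.distrib distrib_left)
  \<comment> \<open>The first sum sits at index 0, since \<open>walks N K 0\<close> is the constant
    1; the second fills the indices from 1 on.\<close>
  also have "\<dots> = (real N / 2) ^ length (s # os) *
      (\<Sum>k\<le>length (s # os). path_coeff (moment N K) (s # os) k * walks N K k x)"
    by (simp only: length_Cons sum.atMost_Suc_shift path_coeff.simps walks.simps power_Suc mult_1_right)
  finally show ?case .
qed

text \<open>The edge \<open>s\<close> prepended here is a dummy: only the coefficient at \<open>0\<close>, which does not depend on
  its orientation, is used.\<close>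

lemma hom_density_oriented_path:
  assumes A: "weighted_tournament N A" and N: "N > 0"
  shows "hom_density (oriented_path os) N A
     = (1 / 2) ^ length os * path_coeff (moment N (skew_kernel N A)) (s # os) 0"
proof -
  let ?m = "length os" and ?K = "skew_kernel N A"
  define L where "L s x y = (if s then A $$ (x, y) else A $$ (y, x))" for s x y
  have L: "L s x y = 1 / 2 + edge_sign s * (real N * ?K x y)" if "x < N" "y < N" for s x y
  proof -
    have "A $$ (x, y) + A $$ (y, x) = 1" using A that by (auto simp: weighted_tournament_def)
    then show ?thesis using N by (simp add: L_def edge_sign_def skew_kernel_def)
  qed
  have inj: "inj_on (\<lambda>i. if os ! i then (i, i + 1) else (i + 1, i)) {0..<?m}"
    by (auto simp: inj_on_def split: if_splits)
  \<comment> \<open>The trailing factor 1 is the value of the constant end function in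
    \<open>sum_PiE_walk\<close>.\<close>
  have prod: "(\<Prod>(x, y)\<in>parcs (oriented_path os). A $$ (\<phi> x, \<phi> y))
      = (\<Prod>i<?m. L (os ! i) (\<phi> i) (\<phi> (Suc i))) * 1" for \<phi>
    unfolding oriented_path_def pair_pre_digraph.simps prod.reindex[OF inj]
    by (auto simp: L_def atLeast0LessThan intro!: prod.cong)
  have "(\<Sum>\<phi>\<in>pverts (oriented_path os) \<rightarrow>\<^sub>E {0..<N}. \<Prod>(x, y)\<in>parcs (oriented_path os). A $$ (\<phi> x, \<phi> y))
      = (\<Sum>x<N. foldr (\<lambda>s g x. \<Sum>y<N. L s x y * g y) os (\<lambda>_. 1) x)"
    unfolding prod using sum_PiE_walk[of L os "\<lambda>_. 1" "{..<N}"]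
    by (simp add: oriented_path_def atLeast0LessThan)
  also have "\<dots> = (\<Sum>x<N. (real N / 2) ^ ?m * (\<Sum>k\<le>?m. path_coeff (moment N ?K) os k * walks N ?K k x))"
    by (intro sum.cong refl foldr_walks N L) auto
  also have "\<dots> = (real N / 2) ^ ?m * (\<Sum>x<N. \<Sum>k\<le>?m. path_coeff (moment N ?K) os k * walks N ?K k x)"
    by (simp only: sum_distrib_left)
  also have "\<dots> = (real N / 2) ^ ?m * (\<Sum>k\<le>?m. \<Sum>x<N. path_coeff (moment N ?K) os k * walks N ?K k x)"
    by (subst sum.swap) (rule refl)
  \<comment> \<open>Summing over the start vertex turns \<open>e_k\<close> into
    \<open>N * b_k\<close>, which up to the factor N is what one more edge does at index 0.\<close>
  also have "\<dots> = (real N / 2) ^ ?m * (real N * path_coeff (moment N ?K) (s # os) 0)"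
  proof -
    have "(\<Sum>x<N. path_coeff (moment N ?K) os k * walks N ?K k x)
        = real N * (moment N ?K k * path_coeff (moment N ?K) os k)" for k
      using N by (simp add: moment_def sum_distrib_left[symmetric])
    then show ?thesis by (simp add: sum_distrib_left)
  qed
  finally show ?thesis
    using N by (simp add: hom_density_def oriented_path_def power_divide)
qed

section \<open>Moments of a skew-symmetric kernel\<close>

definition walk_inner :: "nat \<Rightarrow> (nat \<Rightarrow> nat \<Rightarrow> real) \<Rightarrow> nat \<Rightarrow> nat \<Rightarrow> real" where
  "walk_inner N K j k = (\<Sum>x<N. walks N K j x * walks N K k x)"

definition skew_on :: "nat \<Rightarrow> (nat \<Rightarrow> nat \<Rightarrow> real) \<Rightarrow> bool" where
  "skew_on N K \<longleftrightarrow> (\<forall>x<N. \<forall>y<N. K y x = - K x y)"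

text \<open>A skew-symmetric \<open>K\<close> is anti-self-adjoint.\<close>

lemma walk_inner_shift:
  assumes "skew_on N K"
  shows "walk_inner N K (Suc j) k = - walk_inner N K j (Suc k)"
proof -
  have "walk_inner N K (Suc j) k = (\<Sum>x<N. \<Sum>y<N. K x y * walks N K j y * walks N K k x)"
    by (simp add: walk_inner_def sum_distrib_right)
  also have "\<dots> = (\<Sum>y<N. \<Sum>x<N. K x y * walks N K j y * walks N K k x)"
    by (rule sum.swap)
  also have "\<dots> = (\<Sum>y<N. \<Sum>x<N. - (walks N K j y * (K y x * walks N K k x)))"
  proof (intro sum.cong refl)
    fix x y assume "y \<in> {..<N}" "x \<in> {..<N}"
    then have "K x y = - K y x" using assms unfolding skew_on_def by blast
    then show "K x y * walks N K j y * walks N K k x = - (walks N K j y * (K y x * walks N K k x))"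
      by simp
  qed
  finally show ?thesis by (simp add: walk_inner_def sum_distrib_left sum_negf)
qed

lemma walk_inner_commute: "walk_inner N K j k = walk_inner N K k j"
  by (simp add: walk_inner_def mult.commute)

lemma walk_inner_diag_nonneg: "walk_inner N K k k \<ge> 0"
  by (simp add: walk_inner_def sum_nonneg)

text \<open>Moves \<open>j\<close> of the factors in <1, K^(j+k) 1> to the other side, each at the
  cost of a sign.\<close>

lemma moment_walk_inner:
  assumes "skew_on N K"
  shows "moment N K (j + k) = (- 1) ^ j * walk_inner N K j k / real N"
proof (induction j arbitrary: k)
  case 0
  show ?case by (simp add: moment_def walk_inner_def)
next
  case (Suc j)
  from Suc[of "Suc k"] show ?case by (simp add: walk_inner_shift[OF assms])
qed

lemma moment_odd:
  assumes "skew_on N K" "odd k"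
  shows "moment N K k = 0"
proof -
  from \<open>odd k\<close> obtain j where j: "k = j + Suc j" by (auto elim!: oddE simp: mult_2)
  \<comment> \<open>By the shift and the symmetry of the inner product this value is its own
    negative.\<close>
  have "walk_inner N K j (Suc j) = 0"
    using walk_inner_shift[OF assms(1), of j j] walk_inner_commute[of N K j "Suc j"] by simp
  then show ?thesis unfolding j moment_walk_inner[OF assms(1)] by simp
qed

lemma moment_even:
  assumes "skew_on N K"
  shows "moment N K (2 * j) = (- 1) ^ j * (walk_inner N K j j / real N)"
  using moment_walk_inner[OF assms, of j j] by (simp add: mult_2)

text \<open>By convexity a single positive increment would persist, so the sequence would grow at
  least linearly.\<close>

lemma convex_bounded_decreasing:
  fixes a :: "nat \<Rightarrow> real"
  assumes convex: "\<And>k. 2 * a (Suc k) \<le> a k + a (Suc (Suc k))" and bounded: "\<And>k. a k \<le> C"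
  shows "a (Suc k) \<le> a k"
proof (rule ccontr)
  assume "\<not> a (Suc k) \<le> a k"
  then have d: "a (Suc k) - a k > 0" by simp
  have step: "a (Suc (k + i)) - a (k + i) \<ge> a (Suc k) - a k" for i
  proof (induction i)
    case (Suc i)
    then show ?case using convex[of "k + i"] by simp
  qed simp
  have grow: "a (k + i) \<ge> a k + real i * (a (Suc k) - a k)" for i
  proof (induction i)
    case (Suc i)
    then show ?case using step[of i] by (simp add: algebra_simps)
  qed simp
  obtain i where "C - a k < real i * (a (Suc k) - a k)"
    using reals_Archimedean3[OF d] by blast
  then show False using grow[of i] bounded[of "k + i"] by linarith
qed

text \<open>The normalised squares \<open>a k = |e_k|^2 / r^(2k)\<close> are bounded, and convex
  because skew symmetry makes \<open>a (Suc k)\<close> minus an inner product of the two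
  neighbouring vectors. As \<open>C\<close> is absent from the conclusion, it may depend on N and on
  the kernel.\<close>

lemma walk_inner_contract:
  assumes skew: "skew_on N K" and r: "r > 0"
    and bounded: "\<And>k x. x < N \<Longrightarrow> \<bar>walks N K k x / r ^ k\<bar> \<le> C"
  shows "walk_inner N K (Suc k) (Suc k) \<le> r\<^sup>2 * walk_inner N K k k"
proof -
  define f where "f k x = walks N K k x / r ^ k" for k x
  define a where "a k = (\<Sum>x<N. (f k x)\<^sup>2)" for k
  have a: "walk_inner N K k k = r ^ (2 * k) * a k" for k
    using r by (simp add: walk_inner_def a_def f_def sum_distrib_left power_divide power2_eq_square
        mult_2 power_add)
  have "a (Suc k) \<le> a k"
  proof (rule convex_bounded_decreasing)
    fix k
    have "r ^ (2 * Suc k) * a (Suc k) = walk_inner N K (Suc k) (Suc k)" by (simp only: a)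
    also have "\<dots> = - walk_inner N K k (Suc (Suc k))" by (rule walk_inner_shift[OF skew])
    also have "\<dots> = r ^ (2 * Suc k) * (\<Sum>x<N. - (f k x * f (Suc (Suc k)) x))"
    proof -
      have "r ^ (2 * Suc k) = r ^ k * r ^ Suc (Suc k)" by (simp add: power_add[symmetric] mult_2)
      then have "walks N K k x * walks N K (Suc (Suc k)) x
          = r ^ (2 * Suc k) * (f k x * f (Suc (Suc k)) x)" for x
        using r by (simp add: f_def del: walks.simps)
      then show ?thesis by (simp add: walk_inner_def sum_distrib_left sum_negf del: walks.simps)
    qed
    finally have "a (Suc k) = (\<Sum>x<N. - (f k x * f (Suc (Suc k)) x))" using r by simp
    then have "2 * a (Suc k) = (\<Sum>x<N. - (2 * f k x * f (Suc (Suc k)) x))"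
      by (simp add: sum_distrib_left mult_ac sum_negf)
    also have "\<dots> \<le> (\<Sum>x<N. (f k x)\<^sup>2 + (f (Suc (Suc k)) x)\<^sup>2)"
    proof (rule sum_mono)
      fix x
      have "0 \<le> (f k x + f (Suc (Suc k)) x)\<^sup>2" by simp
      then show "- (2 * f k x * f (Suc (Suc k)) x) \<le> (f k x)\<^sup>2 + (f (Suc (Suc k)) x)\<^sup>2"
        by (simp add: power2_sum)
    qed
    finally show "2 * a (Suc k) \<le> a k + a (Suc (Suc k))" by (simp add: a_def sum.distrib)
    have "a k \<le> (\<Sum>x<N. C\<^sup>2)"
      unfolding a_def
    proof (rule sum_mono)
      fix x assume "x \<in> {..<N}"
      then have "\<bar>f k x\<bar> \<le> C" using bounded by (simp add: f_def)
      then show "(f k x)\<^sup>2 \<le> C\<^sup>2" using power_mono[of "\<bar>f k x\<bar>" C 2] by simp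
    qed
    then show "a k \<le> real N * C\<^sup>2" by simp
  qed
  then have "r ^ (2 * Suc k) * a (Suc k) \<le> r ^ (2 * Suc k) * a k"
    using r by (intro mult_left_mono) auto
  then show ?thesis by (simp only: a) (simp add: mult_ac power2_eq_square)
qed

section \<open>Spectral radius and boundedness of powers\<close>

lemma spectral_radius_smult_less:
  assumes B: "B \<in> carrier_mat N N" and N: "N > 0" and c: "c > 0"
    and less: "spectral_radius B < 1 / c"
  shows "spectral_radius (complex_of_real c \<cdot>\<^sub>m B) < 1"
proof -
  let ?M = "complex_of_real c \<cdot>\<^sub>m B"
  have M: "?M \<in> carrier_mat N N" using B by simp
  obtain l where l: "eigenvalue ?M l" and eq: "spectral_radius ?M = norm l"
    using spectral_radius_mem_max(1)[OF M N] by (auto simp: spectrum_def)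
  then obtain v where v: "v \<in> carrier_vec N" "v \<noteq> 0\<^sub>v N" "?M *\<^sub>v v = l \<cdot>\<^sub>v v"
    using B by (auto simp: eigenvalue_def eigenvector_def)
  \<comment> \<open>An eigenvector of \<open>?M\<close> for \<open>l\<close> is one of
    \<open>B\<close> for \<open>l / c\<close>.\<close>
  have "B *\<^sub>v v = (l / of_real c) \<cdot>\<^sub>v v"
  proof (rule eq_vecI)
    fix i assume i: "i < dim_vec ((l / of_real c) \<cdot>\<^sub>v v)"
    then have i': "i < N" using v by simp
    have "(?M *\<^sub>v v) $ i = l * v $ i" unfolding v(3) using i' v(1) by simp
    moreover have "(?M *\<^sub>v v) $ i = of_real c * (B *\<^sub>v v) $ i"
      using i' v(1) B by simp
    ultimately show "(B *\<^sub>v v) $ i = ((l / of_real c) \<cdot>\<^sub>v v) $ i"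
      using i c by (simp add: field_simps)
  qed (use B v in auto)
  then have "eigenvalue B (l / of_real c)"
    using B v by (auto simp: eigenvalue_def eigenvector_def)
  then have "norm (l / of_real c) \<le> spectral_radius B"
    by (intro spectral_radius_mem_max(2)[OF B N]) (auto simp: spectrum_def)
  then have "norm l / c < 1 / c" using less c by (simp add: norm_divide)
  then show ?thesis using c eq by (simp add: divide_less_cancel)
qed

text \<open>Matrix powers are defined by multiplication on the right, whereas \<open>walks\<close>
  applies the kernel on the left.\<close>

lemma pow_mat_Suc_left:
  assumes "M \<in> carrier_mat n n"
  shows "M ^\<^sub>m Suc k = M * M ^\<^sub>m k"
proof (induction k)
  case 0
  show ?case using assms by simp
next
  case (Suc k)
  have "M ^\<^sub>m Suc (Suc k) = (M * M ^\<^sub>m k) * M" using Suc by simp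
  also have "\<dots> = M * (M ^\<^sub>m k * M)"
    by (rule assoc_mult_mat[of _ n n _ n _ n]) (use assms in auto)
  finally show ?case by simp
qed

text \<open>The entries are complex because the spectral radius refers to complex matrices; the
  scaling \<open>c\<close> will be 1/r.\<close>

lemma walks_pow_mat:
  fixes c :: real and N :: nat and K :: "nat \<Rightarrow> nat \<Rightarrow> real"
  defines "M \<equiv> mat N N (\<lambda>(x, y). complex_of_real (c * K x y))"
  shows "M ^\<^sub>m k *\<^sub>v vec N (\<lambda>_. 1) = vec N (\<lambda>x. complex_of_real (c ^ k * walks N K k x))"
proof (induction k)
  case 0
  show ?case by (auto simp: M_def intro!: eq_vecI)
next
  case (Suc k)
  have M: "M \<in> carrier_mat N N" by (simp add: M_def)
  have "M ^\<^sub>m Suc k *\<^sub>v vec N (\<lambda>_. 1) = M *\<^sub>v (M ^\<^sub>m k *\<^sub>v vec N (\<lambda>_. 1))"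
    unfolding pow_mat_Suc_left[OF M] by (rule assoc_mult_mat_vec) (use M in auto)
  also have "\<dots> = vec N (\<lambda>x. complex_of_real (c ^ Suc k * walks N K (Suc k) x))"
    unfolding Suc
    by (rule eq_vecI)
       (auto simp: M_def scalar_prod_def sum_distrib_left mult_ac atLeast0LessThan intro!: sum.cong)
  finally show ?case .
qed

lemma skew_on_skew_kernel:
  assumes "weighted_tournament N A"
  shows "skew_on N (skew_kernel N A)"
  unfolding skew_on_def
proof (intro allI impI)
  fix x y assume "x < N" "y < N"
  then have "A $$ (x, y) + A $$ (y, x) = 1" using assms by (auto simp: weighted_tournament_def)
  then have "A $$ (y, x) - 1 / 2 = - (A $$ (x, y) - 1 / 2)" by simp
  then show "skew_kernel N A y x = - skew_kernel N A x y"
    unfolding skew_kernel_def by (simp only: minus_divide_left)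
qed

text \<open>The matrix of K / r has spectral radius below 1, so its powers have bounded entries, and
  the quotients here are their row sums.\<close>

lemma walks_bounded:
  assumes A: "weighted_tournament N A" and N: "N > 0" and r: "r > 0"
    and less: "lambda_max (skew_part N A) < r * real N"
  shows "\<exists>C. \<forall>k. \<forall>x<N. \<bar>walks N (skew_kernel N A) k x / r ^ k\<bar> \<le> C"
proof -
  let ?K = "skew_kernel N A"
  define B where "B = map_mat complex_of_real (skew_part N A)"
  define M where "M = mat N N (\<lambda>(x, y). complex_of_real (1 / r * ?K x y))"
  have carr: "A \<in> carrier_mat N N" using A by (simp add: weighted_tournament_def)
  have B: "B \<in> carrier_mat N N" using carr by (auto simp: B_def skew_part_def all_ones_mat_def)
  have M: "M \<in> carrier_mat N N" by (simp add: M_def)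
  have MB: "M = complex_of_real (1 / (r * real N)) \<cdot>\<^sub>m B"
    using carr by (intro eq_matI)
      (auto simp: M_def B_def skew_part_def all_ones_mat_def skew_kernel_def field_simps)
  have "spectral_radius M < 1"
    unfolding MB using r N less
    by (intro spectral_radius_smult_less[OF B N]) (auto simp: lambda_max_def B_def)
  then obtain c where c: "\<And>k. norm_bound (M ^\<^sub>m k) c"
    using spectral_radius_jnf_norm_bound_less_1_upper_triangular[OF M] by blast
  have "\<bar>walks N ?K k x / r ^ k\<bar> \<le> real N * c" if x: "x < N" for k x
  proof -
    have "\<bar>walks N ?K k x / r ^ k\<bar> = norm (complex_of_real ((1 / r) ^ k * walks N ?K k x))"
      by (simp only: norm_of_real) (simp add: power_divide)
    also have "complex_of_real ((1 / r) ^ k * walks N ?K k x) = (M ^\<^sub>m k *\<^sub>v vec N (\<lambda>_. 1)) $ x"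
      unfolding M_def walks_pow_mat using x by simp
    also have "\<dots> = (\<Sum>y<N. (M ^\<^sub>m k) $$ (x, y))"
      using x M by (simp add: scalar_prod_def atLeast0LessThan)
    also have "norm \<dots> \<le> (\<Sum>y<N. c)"
      using c[of k] M x by (intro sum_norm_le) (auto simp: norm_bound_def)
    finally show ?thesis by simp
  qed
  then show ?thesis by blast
qed

text \<open>Odd moments vanish, and the even ones have modulus \<open>a j = |e_j|^2 / N\<close>,
  which starts at 1 and contracts by r^2 in each step.\<close>

lemma small_moments_skew_kernel:
  assumes A: "weighted_tournament N A" and N: "N > 0" and r: "0 < r" "r \<le> 1"
    and less: "lambda_max (skew_part N A) < r * real N"
  shows "small_moments (r\<^sup>2) (moment N (skew_kernel N A))"
proof -
  let ?K = "skew_kernel N A"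
  note skew = skew_on_skew_kernel[OF A]
  obtain C where C: "\<And>k x. x < N \<Longrightarrow> \<bar>walks N ?K k x / r ^ k\<bar> \<le> C"
    using walks_bounded[OF A N r(1) less] by blast
  define a where "a k = walk_inner N ?K k k / real N" for k
  have a_nonneg: "a k \<ge> 0" for k by (simp add: a_def walk_inner_diag_nonneg)
  have contract: "a (Suc k) \<le> r\<^sup>2 * a k" for k
    using divide_right_mono[OF walk_inner_contract[OF skew r(1) C, of k], of "real N"]
    by (simp add: a_def)
  have r2: "0 \<le> r\<^sup>2" "r\<^sup>2 \<le> 1" using r by (auto simp: power_le_one)
  have decr: "a (Suc k) \<le> a k" for k
    using contract[of k] mult_right_mono[OF r2(2) a_nonneg[of k]] by simp
  have a0: "a 0 = 1" using N by (simp add: a_def walk_inner_def)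
  have abs_even: "\<bar>moment N ?K (2 * j)\<bar> = a j" for j
    using a_nonneg[of j] unfolding moment_even[OF skew] a_def[symmetric]
    by (simp add: abs_mult power_abs)
  \<comment> \<open>The contraction is used once, from 1 to 2; afterwards monotonicity
    suffices.\<close>
  have tail: "a j \<le> r\<^sup>2 * a 1" if "j \<ge> 2" for j
    using that
  proof (induction j rule: dec_induct)
    case base
    show ?case using contract[of 1] by (simp add: numeral_2_eq_2)
  next
    case (step j)
    then show ?case using decr[of j] by simp
  qed
  show ?thesis
    unfolding small_moments_def
  proof (intro conjI allI impI)
    show "moment N ?K 0 = 1" using N by (simp add: moment_def)
    show "moment N ?K 1 = 0" by (rule moment_odd[OF skew]) simp
    show "\<bar>moment N ?K 2\<bar> \<le> r\<^sup>2" using abs_even[of 1] contract[of 0] a0 by simp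
    show "r\<^sup>2 \<le> 1" by (rule r2)
    fix k :: nat assume k: "3 \<le> k"
    show "\<bar>moment N ?K k\<bar> \<le> r\<^sup>2 * \<bar>moment N ?K 2\<bar>"
    proof (cases "odd k")
      case True
      then show ?thesis using moment_odd[OF skew] r2 by simp
    next
      case False
      then obtain j where j: "k = 2 * j" by auto
      then show ?thesis using abs_even[of j] abs_even[of 1] tail[of j] k by simp
    qed
  qed
qed

section \<open>Classification of oriented paths\<close>

text \<open>The error constant 2 is half of the 4 in the main term, so the error cannot change the
  sign when \<open>turn_sum os\<close> is a nonzero integer.\<close>

lemma path_density_near_half:
  "\<exists>\<epsilon>>0. \<forall>N>0. \<forall>A. weighted_tournament N A \<and> lambda_max (skew_part N A) \<le> \<epsilon> * real N \<longrightarrow>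
     \<bar>2 ^ length os * hom_density (oriented_path os) N A - 1
        - 4 * moment N (skew_kernel N A) 2 * turn_sum os\<bar>
     \<le> 2 * \<bar>moment N (skew_kernel N A) 2\<bar>"
proof -
  obtain C where C: "\<And>b \<delta>. small_moments \<delta> b \<Longrightarrow>
      \<bar>path_coeff b (True # os) 0 - 1 - 4 * b 2 * turn_sum os\<bar> \<le> C * (\<delta> * \<bar>b 2\<bar>)"
    using path_density_approx[of True os] by blast
  \<comment> \<open>Chosen so that |C| * r <= 1 and r <= 1, which keeps the error factor C * r^2
    below 2.\<close>
  define r where "r = min 1 (1 / (\<bar>C\<bar> + 1))"
  have r: "0 < r" "r \<le> 1" by (auto simp: r_def)
  have "\<bar>C\<bar> * r \<le> \<bar>C\<bar> * (1 / (\<bar>C\<bar> + 1))" by (intro mult_left_mono) (auto simp: r_def)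
  also have "\<dots> \<le> 1" by (simp add: divide_simps)
  finally have "\<bar>C\<bar> * r * r \<le> 1 * 1" using r by (intro mult_mono) auto
  then have Cr: "C * r\<^sup>2 \<le> 2"
    using mult_right_mono[OF abs_ge_self[of C], of "r\<^sup>2"] by (simp add: power2_eq_square mult_ac)
  show ?thesis
  \<comment> \<open>Halving \<open>r\<close> turns the non-strict eigenvalue bound into the strict
    one of \<open>small_moments_skew_kernel\<close>.\<close>
  proof (intro exI[of _ "r / 2"] conjI allI impI; (elim conjE)?)
    show "r / 2 > 0" using r by simp
    fix N :: nat and A
    assume N: "N > 0" and A: "weighted_tournament N A"
      and less: "lambda_max (skew_part N A) \<le> r / 2 * real N"
    let ?b = "moment N (skew_kernel N A)"
    have "r / 2 * real N < r * real N" using r N by simp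
    then have "small_moments (r\<^sup>2) ?b"
      using small_moments_skew_kernel[OF A N r] less by linarith
    then have "\<bar>path_coeff ?b (True # os) 0 - 1 - 4 * ?b 2 * turn_sum os\<bar> \<le> C * r\<^sup>2 * \<bar>?b 2\<bar>"
      using C by (simp only: mult.assoc)
    also have "\<dots> \<le> 2 * \<bar>?b 2\<bar>" using Cr by (rule mult_right_mono) simp
    also have "path_coeff ?b (True # os) 0 = 2 ^ length os * hom_density (oriented_path os) N A"
      by (subst hom_density_oriented_path[OF A N, of os True]) (simp add: power_divide)
    finally show "\<bar>2 ^ length os * hom_density (oriented_path os) N A - 1 - 4 * ?b 2 * turn_sum os\<bar>
        \<le> 2 * \<bar>?b 2\<bar>" .
  qed
qed

lemma moment_2_nonpos:
  assumes "weighted_tournament N A"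
  shows "moment N (skew_kernel N A) 2 \<le> 0"
  using moment_even[OF skew_on_skew_kernel[OF assms], of 1]
    walk_inner_diag_nonneg[of N "skew_kernel N A" 1] by simp

text \<open>The strict sign of the moment lets these tournaments refute LTS or LTAS at any given
  threshold. On two vertices \<open>B\<close> is \<open>d\<close> times a quarter turn, with
  eigenvalues \<open>i d\<close> and \<open>-i d\<close>.\<close>

lemma tournament_small_spectrum:
  assumes e: "e > 0"
  shows "\<exists>N>0. \<exists>A. weighted_tournament N A \<and> lambda_max (skew_part N A) \<le> e * real N
    \<and> moment N (skew_kernel N A) 2 < 0"
proof -
  \<comment> \<open>The bound 1/2 keeps the entries of \<open>A\<close> in [0,1]; the bound
    \<open>e\<close> controls the spectrum.\<close>
  define d where "d = min e (1 / 2)"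
  have d: "0 < d" "d \<le> 1 / 2" "d \<le> e" using e by (auto simp: d_def)
  define A where "A = mat 2 2 (\<lambda>(x, y). if x < y then 1 / 2 + d else if y < x then 1 / 2 - d else 1 / 2)"
  define B where "B = map_mat complex_of_real (skew_part 2 A)"
  have lt2: "x < 2 \<longleftrightarrow> x = 0 \<or> x = 1" for x :: nat by auto
  have wt: "weighted_tournament 2 A"
    using d by (auto simp: weighted_tournament_def A_def lt2)
  have B: "B \<in> carrier_mat 2 2" by (auto simp: B_def skew_part_def all_ones_mat_def A_def)
  obtain l where l: "eigenvalue B l" and eq: "spectral_radius B = norm l"
    using spectral_radius_mem_max(1)[OF B] by (auto simp: spectrum_def)
  then obtain v where v: "v \<in> carrier_vec 2" "v \<noteq> 0\<^sub>v 2" "B *\<^sub>v v = l \<cdot>\<^sub>v v"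
    using B by (auto simp: eigenvalue_def eigenvector_def)
  have entry: "(B *\<^sub>v v) $ i = B $$ (i, 0) * v $ 0 + B $$ (i, 1) * v $ 1" if "i < 2" for i
    using that B v(1) by (simp add: scalar_prod_def numeral_2_eq_2)
  have v0: "of_real d * v $ 1 = l * v $ 0"
    using entry[of 0] v(1) by (simp add: v(3)) (simp add: B_def skew_part_def all_ones_mat_def A_def)
  have v1: "- of_real d * v $ 0 = l * v $ 1"
    using entry[of 1] v(1) by (simp add: v(3)) (simp add: B_def skew_part_def all_ones_mat_def A_def)
  \<comment> \<open>Using both eigenvector equations in turn expresses B^2 = -d^2 I in each
    coordinate; a nonzero coordinate then determines the square of \<open>l\<close>.\<close>
  have "l\<^sup>2 * v $ 0 = l * (of_real d * v $ 1)" by (simp only: v0 power2_eq_square mult.assoc)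
  also have "\<dots> = of_real d * (l * v $ 1)" by (rule mult.left_commute)
  also have "\<dots> = - (of_real d)\<^sup>2 * v $ 0" by (simp only: v1[symmetric]) (simp add: power2_eq_square)
  finally have "l\<^sup>2 * v $ 0 = - (of_real d)\<^sup>2 * v $ 0" .
  moreover have "l\<^sup>2 * v $ 1 = - (of_real d)\<^sup>2 * v $ 1"
  proof -
    have "l\<^sup>2 * v $ 1 = l * (- of_real d * v $ 0)" by (simp only: v1 power2_eq_square mult.assoc)
    also have "\<dots> = - of_real d * (l * v $ 0)" by (rule mult.left_commute)
    also have "\<dots> = - (of_real d)\<^sup>2 * v $ 1" by (simp only: v0[symmetric]) (simp add: power2_eq_square)
    finally show ?thesis .
  qed
  moreover have "v $ 0 \<noteq> 0 \<or> v $ 1 \<noteq> 0"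
    using v(1,2) by (auto simp: lt2 intro!: eq_vecI)
  ultimately have "l\<^sup>2 = - (of_real d)\<^sup>2" using mult_right_cancel by blast
  then have "(norm l)\<^sup>2 = d\<^sup>2" by (metis norm_minus_cancel norm_of_real norm_power power2_abs)
  then have "norm l = d" using d by (simp add: power2_eq_iff_nonneg)
  then have "lambda_max (skew_part 2 A) \<le> e * real 2"
    using eq d by (simp add: lambda_max_def B_def)
  moreover have "moment 2 (skew_kernel 2 A) 2 = - (d\<^sup>2 / 4)"
    by (simp add: moment_def skew_kernel_def A_def numeral_2_eq_2 field_simps)
  ultimately show ?thesis
    using wt d by (intro exI[of _ 2] conjI exI[of _ A]) auto
qed

lemma half_power_le_iff: "(1 / 2) ^ m \<le> t \<longleftrightarrow> 0 \<le> 2 ^ m * t - (1::real)"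
  and le_half_power_iff: "t \<le> (1 / 2) ^ m \<longleftrightarrow> 2 ^ m * t - (1::real) \<le> 0"
  by (simp_all add: power_divide divide_simps mult.commute)

text \<open>The turn sum is the integer 2 * agreements - n. If it is nonzero, the main term has
  modulus at least 4 |b_2| against an error of at most 2 |b_2|; since b_2 <= 0, the density deviates
  with the opposite sign. A tournament with b_2 < 0 excludes the other property.\<close>

lemma oriented_path_classification:
  assumes len: "length os = n + 1"
  shows "2 * agreements os < n \<Longrightarrow> LTS (oriented_path os) \<and> \<not> LTAS (oriented_path os)"
    and "n < 2 * agreements os \<Longrightarrow> LTAS (oriented_path os) \<and> \<not> LTS (oriented_path os)"
proof -
  let ?t = "\<lambda>N A. 2 ^ length os * hom_density (oriented_path os) N A - 1"
  let ?b = "\<lambda>N A. moment N (skew_kernel N A) 2"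
  obtain \<epsilon> where \<epsilon>: "\<epsilon> > 0" and bound: "\<And>N A. N > 0 \<Longrightarrow> weighted_tournament N A \<Longrightarrow>
      lambda_max (skew_part N A) \<le> \<epsilon> * real N \<Longrightarrow>
      \<bar>?t N A - 4 * ?b N A * turn_sum os\<bar> \<le> 2 * \<bar>?b N A\<bar>"
    using path_density_near_half[of os] by blast
  have turn: "turn_sum os = real_of_int (2 * int (agreements os) - int n)"
    using len by (simp add: turn_sum_agreements)
  note iffs = half_power_le_iff le_half_power_iff
  have witness: "\<exists>N>0. \<exists>A. weighted_tournament N A \<and> lambda_max (skew_part N A) \<le> \<epsilon>' * real N
      \<and> lambda_max (skew_part N A) \<le> \<epsilon> * real N \<and> ?b N A < 0" if "\<epsilon>' > 0" for \<epsilon>'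
  proof -
    \<comment> \<open>The minimum serves both the threshold of the estimate and that of the property
      to be refuted.\<close>
    obtain N A where NA: "N > 0" "weighted_tournament N A"
        "lambda_max (skew_part N A) \<le> min \<epsilon> \<epsilon>' * real N" "?b N A < 0"
      using tournament_small_spectrum[of "min \<epsilon> \<epsilon>'"] \<epsilon> \<open>\<epsilon>' > 0\<close> by auto
    moreover have "min \<epsilon> \<epsilon>' * real N \<le> \<epsilon> * real N" "min \<epsilon> \<epsilon>' * real N \<le> \<epsilon>' * real N"
      by (intro mult_right_mono; simp)+
    ultimately show ?thesis by (meson order_trans)
  qed
  {
    assume "2 * agreements os < n"
    then have turn_sum: "turn_sum os \<le> - 1" using turn by linarith
    have lower: "?t N A \<ge> - 2 * ?b N A" if "N > 0" "weighted_tournament N A"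
        "lambda_max (skew_part N A) \<le> \<epsilon> * real N" for N A
    proof -
      have b: "?b N A \<le> 0" by (rule moment_2_nonpos[OF that(2)])
      have "4 * ?b N A * turn_sum os \<ge> 4 * ?b N A * - 1"
        by (rule mult_left_mono_neg) (use turn_sum b in auto)
      then show ?thesis using bound[OF that] b by linarith
    qed
    have "LTS (oriented_path os)"
      unfolding LTS_def card_parcs_oriented_path iffs
    proof (intro exI[of _ \<epsilon>] conjI allI impI)
      fix N :: nat and A
      assume "N > 0" "weighted_tournament N A \<and> lambda_max (skew_part N A) \<le> \<epsilon> * real N"
      then show "0 \<le> ?t N A"
        using lower[of N A] moment_2_nonpos[of N A] by linarith
    qed (rule \<epsilon>)
    moreover have "\<not> LTAS (oriented_path os)"
    proof
      assume "LTAS (oriented_path os)"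
      then obtain \<epsilon>' where "\<epsilon>' > 0" and upper: "\<And>N A. N > 0 \<Longrightarrow> weighted_tournament N A \<Longrightarrow>
          lambda_max (skew_part N A) \<le> \<epsilon>' * real N \<Longrightarrow> ?t N A \<le> 0"
        unfolding LTAS_def card_parcs_oriented_path iffs by blast
      from witness[OF this(1)] obtain N A where "N > 0" "weighted_tournament N A"
          "lambda_max (skew_part N A) \<le> \<epsilon>' * real N" "lambda_max (skew_part N A) \<le> \<epsilon> * real N"
          "?b N A < 0" by blast
      then show False using lower[of N A] upper[of N A] by linarith
    qed
    ultimately show "LTS (oriented_path os) \<and> \<not> LTAS (oriented_path os)" ..
  }
  {
    assume "n < 2 * agreements os"
    then have turn_sum: "turn_sum os \<ge> 1" using turn by linarith
    have upper: "?t N A \<le> 2 * ?b N A" if "N > 0" "weighted_tournament N A"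
        "lambda_max (skew_part N A) \<le> \<epsilon> * real N" for N A
    proof -
      have b: "?b N A \<le> 0" by (rule moment_2_nonpos[OF that(2)])
      have "4 * ?b N A * turn_sum os \<le> 4 * ?b N A * 1"
        by (rule mult_left_mono_neg) (use turn_sum b in auto)
      then show ?thesis using bound[OF that] b by linarith
    qed
    have "LTAS (oriented_path os)"
      unfolding LTAS_def card_parcs_oriented_path iffs
    proof (intro exI[of _ \<epsilon>] conjI allI impI)
      fix N :: nat and A
      assume "N > 0" "weighted_tournament N A \<and> lambda_max (skew_part N A) \<le> \<epsilon> * real N"
      then show "?t N A \<le> 0"
        using upper[of N A] moment_2_nonpos[of N A] by linarith
    qed (rule \<epsilon>)
    moreover have "\<not> LTS (oriented_path os)"
    proof
      assume "LTS (oriented_path os)"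
      then obtain \<epsilon>' where "\<epsilon>' > 0" and lower: "\<And>N A. N > 0 \<Longrightarrow> weighted_tournament N A \<Longrightarrow>
          lambda_max (skew_part N A) \<le> \<epsilon>' * real N \<Longrightarrow> 0 \<le> ?t N A"
        unfolding LTS_def card_parcs_oriented_path iffs by blast
      from witness[OF this(1)] obtain N A where "N > 0" "weighted_tournament N A"
          "lambda_max (skew_part N A) \<le> \<epsilon>' * real N" "lambda_max (skew_part N A) \<le> \<epsilon> * real N"
          "?b N A < 0" by blast
      then show False using upper[of N A] lower[of N A] by linarith
    qed
    ultimately show "LTAS (oriented_path os) \<and> \<not> LTS (oriented_path os)" ..
  }
qed

section \<open>Fractions of oriented paths\<close>

lemma path_fraction_mono:
  assumes "\<And>os. length os = m \<Longrightarrow> P (oriented_path os) \<Longrightarrow> Q (agreements os)"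
  shows "path_fraction m P \<le> real (card {os :: bool list. length os = m \<and> Q (agreements os)}) / 2 ^ m"
  unfolding path_fraction_def
  by (intro divide_right_mono of_nat_mono card_mono finite_bool_lists) (use assms in auto)

lemma path_fraction_antimono:
  assumes "\<And>os. length os = m \<Longrightarrow> Q (agreements os) \<Longrightarrow> P (oriented_path os)"
  shows "real (card {os :: bool list. length os = m \<and> Q (agreements os)}) / 2 ^ m \<le> path_fraction m P"
  unfolding path_fraction_def
  by (intro divide_right_mono of_nat_mono card_mono finite_bool_lists) (use assms in auto)

theorem proposition1p7:
  fixes n :: nat
  assumes "n \<ge> 1"
  shows "(odd n \<longrightarrow>
            path_fraction (n + 1) LTS = 1 / 2 \<and>
            path_fraction (n + 1) LTAS = 1 / 2) \<and>
         (even n \<longrightarrow>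
            path_fraction (n + 1) (\<lambda>D. \<not> LTS D \<and> \<not> LTAS D) \<le> real (n choose (n div 2)) / 2 ^ n \<and>
            path_fraction (n + 1) LTS \<ge> 1 / 2 * (1 - real (n choose (n div 2)) / 2 ^ n) \<and>
            path_fraction (n + 1) LTAS \<ge> 1 / 2 * (1 - real (n choose (n div 2)) / 2 ^ n))"
proof -
  let ?up = "real (\<Sum>k | k \<le> n \<and> n < 2 * k. n choose k)"
  let ?mid = "real (n choose (n div 2))"
  have halves: "2 * ?up + (if even n then ?mid else 0) = 2 ^ n"
    using arg_cong[OF sum_choose_halves[of n], of real] by (simp split: if_splits)
  \<comment> \<open>The reflection of \<open>k\<close> to \<open>n - k\<close> equates both halves;
    the factor 2 is the choice of the first edge.\<close>
  have lo: "real (card {os :: bool list. length os = n + 1 \<and> 2 * agreements os < n}) = 2 * ?up"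
    using card_agreements[of n "\<lambda>k. 2 * k < n"] by (simp add: sum_choose_lower_upper)
  have up: "real (card {os :: bool list. length os = n + 1 \<and> n < 2 * agreements os}) = 2 * ?up"
    using card_agreements[of n "\<lambda>k. n < 2 * k"] by simp
  have LTS_ge: "path_fraction (n + 1) LTS \<ge> 2 * ?up / 2 ^ (n + 1)"
    unfolding lo[symmetric] using oriented_path_classification(1)
    by (intro path_fraction_antimono) blast
  have LTAS_ge: "path_fraction (n + 1) LTAS \<ge> 2 * ?up / 2 ^ (n + 1)"
    unfolding up[symmetric] using oriented_path_classification(2)
    by (intro path_fraction_antimono) blast
  show ?thesis
  proof (intro conjI impI)
    assume "odd n"
    \<comment> \<open>For odd \<open>n\<close> no tie occurs, so the classification decides every
      path and its implications reverse.\<close>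
    then have neq: "2 * agreements os \<noteq> n" for os :: "bool list" by auto
    have LTS_iff: "2 * agreements os < n" if "length os = n + 1" "LTS (oriented_path os)" for os
      using oriented_path_classification(2)[OF that(1)] that(2) neq[of os] by linarith
    have LTAS_iff: "n < 2 * agreements os" if "length os = n + 1" "LTAS (oriented_path os)" for os
      using oriented_path_classification(1)[OF that(1)] that(2) neq[of os] by linarith
    have half: "2 * ?up / 2 ^ (n + 1) = 1 / 2" using halves \<open>odd n\<close> by simp
    have "path_fraction (n + 1) LTS \<le> 2 * ?up / 2 ^ (n + 1)"
      unfolding lo[symmetric] by (rule path_fraction_mono) (rule LTS_iff)
    then show "path_fraction (n + 1) LTS = 1 / 2" using LTS_ge half by simp
    have "path_fraction (n + 1) LTAS \<le> 2 * ?up / 2 ^ (n + 1)"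
      unfolding up[symmetric] by (rule path_fraction_mono) (rule LTAS_iff)
    then show "path_fraction (n + 1) LTAS = 1 / 2" using LTAS_ge half by simp
  next
    assume "even n"
    then have half: "2 * ?up / 2 ^ (n + 1) = 1 / 2 * (1 - ?mid / 2 ^ n)"
      using halves by (simp add: field_simps)
    show "path_fraction (n + 1) LTS \<ge> 1 / 2 * (1 - ?mid / 2 ^ n)" using LTS_ge by (simp only: half)
    show "path_fraction (n + 1) LTAS \<ge> 1 / 2 * (1 - ?mid / 2 ^ n)" using LTAS_ge by (simp only: half)
    \<comment> \<open>Only a tie, with agreements equal to n / 2, can leave a path
      undecided.\<close>
    have "path_fraction (n + 1) (\<lambda>D. \<not> LTS D \<and> \<not> LTAS D)
        \<le> real (card {os :: bool list. length os = n + 1 \<and> agreements os = n div 2}) / 2 ^ (n + 1)"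
    proof (rule path_fraction_mono)
      fix os :: "bool list"
      assume "length os = n + 1" "\<not> LTS (oriented_path os) \<and> \<not> LTAS (oriented_path os)"
      then have "\<not> 2 * agreements os < n" "\<not> n < 2 * agreements os"
        using oriented_path_classification by blast+
      then show "agreements os = n div 2" by simp
    qed
    also have "\<dots> = ?mid / 2 ^ n" by (simp add: card_agreements_eq)
    finally show "path_fraction (n + 1) (\<lambda>D. \<not> LTS D \<and> \<not> LTAS D) \<le> ?mid / 2 ^ n" .
  qed
qed

end
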